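(* Let $n,N\ge 1$ be integers (not necessarily equal), $\eta,\hbar\in\mathbb{C}$, and ${\bf g}=\mathrm{diag}(g_1,\dots,g_N)\in GL(N,\mathbb{C})$. Let $M_1,\dots,M_N$ be non-negative integers with $M_1+\dots+M_N=n$. Let $|\Phi\rangle=\sum_J\Phi_J|J\rangle$ be any solution, with values in the weight subspace ${\cal V}(\{M_a\})\subset(\mathbb{C}^N)^{\otimes n}$, of the rational quantum Knizhnik-Zamolodchikov (qKZ) equations $$e^{\eta\hbar\partial_{x_i}}|\Phi\rangle={\bf K}_i^{(\hbar)}|\Phi\rangle,\qquad i=1,\dots,n,$$ and let $\Psi=\sum_J\Phi_J$. Then for every $d=1,\dots,n$ the function $\Psi$ satisfies $\hat{\cal H}_d\Psi=E_d\Psi$, where $$\hat{\cal H}_d=\sum_{I\subset\{1,\dots,n\},\,|I|=d}\Bigl(\prod_{s\in I,\,r\notin I}\frac{x_s-x_r+\eta}{x_s-x_r}\Bigr)\prod_{i\in I}e^{\eta\hbar\partial_{x_i}}$$ is the $d$-th rational Macdonald-Ruijsenaars Hamiltonian and $$E_d=e_d(\underbrace{g_1,\dots,g_1}_{M_1},\dots,\underbrace{g_N,\dots,g_N}_{M_N}),$$ with $e_d$ the $d$-th elementary symmetric polynomial in $n$ variables.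
   Context: Let $V=\mathbb{C}^N$ with standard basis $e_1,\dots,e_N$, and ${\cal V}=V^{\otimes n}$. For $1\le i\neq j\le n$, ${\bf P}_{ij}$ is the operator on ${\cal V}$ permuting the $i$-th and $j$-th tensor factors, ${\bf I}$ is the identity, and ${\bf g}^{(i)}$ acts as ${\bf g}$ on the $i$-th factor and identically on all other factors. The rational $R$-matrix is $${\bf R}_{ij}(x)=\frac{x{\bf I}+\eta{\bf P}_{ij}}{x+\eta}.$$ The qKZ operators are, for $i=1,\dots,n$, $${\bf K}_i^{(\hbar)}={\bf R}_{i\,i-1}(x_i-x_{i-1}+\eta\hbar)\cdots{\bf R}_{i1}(x_i-x_1+\eta\hbar)\,{\bf g}^{(i)}\,{\bf R}_{in}(x_i-x_n)\cdots{\bf R}_{i\,i+1}(x_i-x_{i+1}),$$ where the product to the left of ${\bf g}^{(i)}$ has second indices decreasing from $i-1$ to $1$ (empty for $i=1$) and the product to the right has second indices decreasing from $n$ to $i+1$ (empty for $i=n$). The operator $e^{\eta\hbar\partial_{x_i}}$ is the shift $(e^{\eta\hbar\partial_{x_i}}f)(x_1,\dots,x_n)=f(x_1,\dots,x_i+\eta\hbar,\dots,x_n)$. Weight subspaces: ${\cal V}(\{M_a\})$ is the span of the vectors $|J\rangle=e_{j_1}\otimes\dots\otimes e_{j_n}$ over all multi-indices $J=(j_1,\dots,j_n)\in\{1,\dots,N\}^n$ in which the value $a$ occurs exactly $M_a$ times, for every $a=1,\dots,N$. Sums over $J$ are over these multi-indices. Domain convention: $\Phi_J$ are complex-valued functions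 on a set $X\subset\mathbb{C}^n$ that is mapped to itself by each shift $x_i\mapsto x_i+\eta\hbar$ and on which the points are in general position, i.e. $x_i\ne x_j$ and $x_i\neq x_j\pm\eta$ for all $i\ne j$. All equations are understood to hold at every point of $X$. *)

theory Defs
  imports "HOL-Analysis.Analysis" "HOL-Combinatorics.Transposition"
begin

text \<open>
  The standard basis of \<open>V = \<complex>\<^sup>N\<close> is indexed by a finite type \<open>'N\<close> (so \<open>N = CARD('N)\<close>), the tensor
  factors by \<open>{1..n}\<close>.  A vector of the \<open>n\<close>-fold tensor power of \<open>V\<close> is identified with the function
  assigning to each multi-index \<open>J\<close> its coefficient at \<open>|J\<rangle>\<close>, with value 0 at functions
  \<open>J\<close> that are not multi-indices.  All operators below map such functions to such functions.
\<close>

type_synonym 'N tensor = "(nat \<Rightarrow> 'N) \<Rightarrow> complex"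

definition multi_indices :: "nat \<Rightarrow> (nat \<Rightarrow> 'N) set" where
  "multi_indices n = {1..n} \<rightarrow>\<^sub>E UNIV"

definition ket :: "(nat \<Rightarrow> 'N) \<Rightarrow> 'N tensor" where
  "ket J = (\<lambda>K. if K = J then 1 else 0)"

definition weight_indices :: "nat \<Rightarrow> ('N \<Rightarrow> nat) \<Rightarrow> (nat \<Rightarrow> 'N) set" where
  "weight_indices n M = {J \<in> multi_indices n. \<forall>a. card {i \<in> {1..n}. J i = a} = M a}"

definition weight_space :: "nat \<Rightarrow> ('N \<Rightarrow> nat) \<Rightarrow> 'N tensor set" where
  "weight_space n M = {v. \<exists>c. v = (\<lambda>K. \<Sum>J\<in>weight_indices n M. c J * ket J K)}"

definition perm_op :: "nat \<Rightarrow> nat \<Rightarrow> 'N tensor \<Rightarrow> 'N tensor" where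
  "perm_op i j v = (\<lambda>J. v (J \<circ> Transposition.transpose i j))"

definition R_op :: "complex \<Rightarrow> nat \<Rightarrow> nat \<Rightarrow> complex \<Rightarrow> 'N tensor \<Rightarrow> 'N tensor" where
  "R_op \<eta> i j u v = (\<lambda>J. (u * v J + \<eta> * perm_op i j v J) / (u + \<eta>))"

definition site_op :: "nat \<Rightarrow> complex^'N^'N \<Rightarrow> 'N::finite tensor \<Rightarrow> 'N tensor" where
  "site_op i A v = (\<lambda>J. \<Sum>b\<in>UNIV. A $ J i $ b * v (J(i := b)))"

definition diag_mat :: "('N \<Rightarrow> complex) \<Rightarrow> complex^'N^'N" where
  "diag_mat g = (\<chi> a b. if a = b then g a else 0)"

definition op_prod :: "('v \<Rightarrow> 'v) list \<Rightarrow> 'v \<Rightarrow> 'v" where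
  "op_prod Fs = foldr (\<circ>) Fs id"

definition qKZ_op ::
  "nat \<Rightarrow> complex \<Rightarrow> complex \<Rightarrow> complex^'N^'N \<Rightarrow> nat \<Rightarrow> (nat \<Rightarrow> complex) \<Rightarrow> 'N::finite tensor \<Rightarrow> 'N tensor"
where
  "qKZ_op n \<eta> hbar G i x =
     op_prod (map (\<lambda>j. R_op \<eta> i j (x i - x j + \<eta> * hbar)) (rev [1..<i]))
     \<circ> site_op i G
     \<circ> op_prod (map (\<lambda>j. R_op \<eta> i j (x i - x j)) (rev [i+1..<n+1]))"

definition shift_op :: "complex \<Rightarrow> nat \<Rightarrow> ((nat \<Rightarrow> complex) \<Rightarrow> 'v) \<Rightarrow> (nat \<Rightarrow> complex) \<Rightarrow> 'v" where
  "shift_op h i f = (\<lambda>x. f (x(i := x i + h)))"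

text \<open>The shifts commute, so the order chosen in their product is immaterial.\<close>

definition MR_hamiltonian ::
  "nat \<Rightarrow> complex \<Rightarrow> complex \<Rightarrow> nat \<Rightarrow> ((nat \<Rightarrow> complex) \<Rightarrow> complex) \<Rightarrow> (nat \<Rightarrow> complex) \<Rightarrow> complex"
where
  "MR_hamiltonian n \<eta> hbar d f = (\<lambda>x.
     \<Sum>I | I \<subseteq> {1..n} \<and> card I = d.
       (\<Prod>s\<in>I. \<Prod>r\<in>{1..n} - I. (x s - x r + \<eta>) / (x s - x r))
       * op_prod (map (shift_op (\<eta> * hbar)) (sorted_list_of_set I)) f x)"

text \<open>Elementary symmetric polynomial of degree \<open>d\<close> in the variables \<open>z k\<close>, \<open>k \<in> A\<close>.\<close>

definition elem_sym :: "nat \<Rightarrow> 'k set \<Rightarrow> ('k \<Rightarrow> complex) \<Rightarrow> complex" where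
  "elem_sym d A z = (\<Sum>S | S \<subseteq> A \<and> card S = d. \<Prod>k\<in>S. z k)"

text \<open>The variables are indexed by pairs \<open>(a, k)\<close>, the \<open>k\<close>-th of the \<open>M a\<close> copies of \<open>g a\<close>.\<close>

definition MR_eigenvalue :: "nat \<Rightarrow> ('N \<Rightarrow> complex) \<Rightarrow> ('N \<Rightarrow> nat) \<Rightarrow> complex" where
  "MR_eigenvalue d g M = elem_sym d (SIGMA a:UNIV. {1..M a}) (\<lambda>(a, k). g a)"

definition general_position :: "nat \<Rightarrow> complex \<Rightarrow> (nat \<Rightarrow> complex) \<Rightarrow> bool" where
  "general_position n \<eta> x \<longleftrightarrow>
     (\<forall>i\<in>{1..n}. \<forall>j\<in>{1..n}. i \<noteq> j \<longrightarrow> x i \<noteq> x j \<and> x i \<noteq> x j + \<eta> \<and> x i \<noteq> x j - \<eta>)"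

end

(*
  Pairing a solution with the sum of all basis covectors absorbs the factors of the qKZ operators to
  the left of g, since every R-matrix fixes that covector; so hbar disappears, and the shifted
  function Psi is the pairing of Phi with a covector determined by I.  A covector is the value at
  z = (g_{j_1}, ..., g_{j_n}) of a function of z, and R-matrices act on such functions by
  exchanging variables.  It remains to show that the weighted sum F_x(z) of these functions over I
  equals e_d(z) for every x in general position.  F_x is multilinear and homogeneous of degree d, so
  it suffices to see that all its coefficients are 1.  By the Yang-Baxter equation and unitarity,
  exchanging x_i with x_{i+1} turns F_x into its image under a braided R-matrix, which expresses the
  coefficient at z_S through the one at the set with i + 1 replaced by i.  The coefficient at
  z_1 ... z_d comes only from I = {1..d}, and there it is the inverse of the weight.
*)
theory Submission imports Defs begin

subsection \<open>Exchange relations\<close>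

abbreviation swap :: "nat \<Rightarrow> nat \<Rightarrow> nat \<Rightarrow> nat" where "swap \<equiv> Transposition.transpose"

section \<open>R-matrices: exchange of sites, unitarity and the Yang-Baxter equation\<close>

lemma transpose_conj:
  "swap a b \<circ> swap i k = swap (swap a b i) (swap a b k) \<circ> swap a b"
  by (auto simp: fun_eq_iff Transposition.transpose_def)

lemma perm_op_perm_op [simp]: "perm_op a b (perm_op a b f) = f"
  by (simp add: perm_op_def comp_assoc)

lemma perm_op_R_op:
  "perm_op a b (R_op \<eta> i k u f) = R_op \<eta> (swap a b i) (swap a b k) u (perm_op a b f)"
  unfolding R_op_def perm_op_def comp_assoc transpose_conj[of a b i k] by (simp add: comp_assoc)

lemma R_op_sym: "R_op \<eta> i k = R_op \<eta> k i"
  by (simp add: R_op_def perm_op_def transpose_commute fun_eq_iff)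

lemma R_op_fixed: "perm_op i k f = f \<Longrightarrow> u + \<eta> \<noteq> 0 \<Longrightarrow> R_op \<eta> i k u f = f"
  by (simp add: R_op_def flip: distrib_right)

lemma R_op_commute:
  assumes "i \<noteq> j" "i \<noteq> l" "k \<noteq> j" "k \<noteq> l"
  shows "R_op \<eta> i k u (R_op \<eta> j l v f) = R_op \<eta> j l v (R_op \<eta> i k u f)"
proof -
  have "swap i k \<circ> swap j l = swap j l \<circ> swap i k"
    using assms by (auto simp: fun_eq_iff Transposition.transpose_def)
  then have "\<And>J. f (J \<circ> swap i k \<circ> swap j l) = f (J \<circ> swap j l \<circ> swap i k)"
    by (simp add: comp_assoc)
  then show ?thesis
    by (simp add: R_op_def perm_op_def fun_eq_iff add_divide_distrib algebra_simps)
qed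

text \<open>As P^2 = 1, the numerators multiply to (\<eta> - u)(\<eta> + u), which the two
  denominators cancel.\<close>

lemma R_op_unitarity:
  assumes "\<eta> + u \<noteq> 0" "\<eta> - u \<noteq> 0"
  shows "R_op \<eta> a b (- u) (R_op \<eta> a b u f) = f"
proof
  fix J
  have "(\<eta> - u) * (\<eta> + u) \<noteq> 0" using assms by simp
  then show "R_op \<eta> a b (- u) (R_op \<eta> a b u f) J = f J"
    using assms
    by (simp add: R_op_def perm_op_def comp_assoc divide_simps add.commute[of _ \<eta>]) (simp add: algebra_simps)
qed

lemma Yang_Baxter:
  assumes "a \<noteq> b" "a \<noteq> c" "b \<noteq> c"
  shows "R_op \<eta> a b (u - v) (R_op \<eta> a c u (R_op \<eta> b c v f))
       = R_op \<eta> b c v (R_op \<eta> a c u (R_op \<eta> a b (u - v) f))"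
proof
  fix J :: "nat \<Rightarrow> 'a"
  define ab bc ac where "ab = swap a b" and "bc = swap b c" and "ac = swap a c"
  \<comment> \<open>\<open>S\<close> is the numerator of an R-matrix. Both sides have the same three
    denominators, so only numerators need to be compared.\<close>
  define S where "S t w h = (\<lambda>J. w * h J + \<eta> * h (J \<circ> t))" for t w and h :: "'a tensor"
  have R: "R_op \<eta> i k w h = (\<lambda>J. S (swap i k) w h J / (w + \<eta>))" for i k w h
    by (simp add: S_def R_op_def perm_op_def)
  have S_div: "S t w (\<lambda>J. h J / q) = (\<lambda>J. S t w h J / q)" for t w h q
    by (simp add: S_def add_divide_distrib)
  \<comment> \<open>Rewrite rules in the symmetric group on three letters: the 3-cycles get the
    normal forms \<open>bc \<circ> ab\<close> and \<open>ac \<circ> ab\<close>, and products of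
    three transpositions collapse to one.\<close>
  have rel: "ab \<circ> ac = bc \<circ> ab" "ac \<circ> bc = bc \<circ> ab" "ab \<circ> bc = ac \<circ> ab" "bc \<circ> ac = ac \<circ> ab"
    "ac \<circ> (ac \<circ> ab) = ab" "ab \<circ> (bc \<circ> ab) = ac" "bc \<circ> (ac \<circ> ab) = ac"
    using assms by (auto simp: fun_eq_iff Transposition.transpose_def ab_def bc_def ac_def)
  have "S ab (u - v) (S ac u (S bc v f)) J = S bc v (S ac u (S ab (u - v) f)) J"
    by (simp add: S_def comp_assoc rel) (simp add: algebra_simps)
  then show "R_op \<eta> a b (u - v) (R_op \<eta> a c u (R_op \<eta> b c v f)) J
       = R_op \<eta> b c v (R_op \<eta> a c u (R_op \<eta> a b (u - v) f)) J"
    by (simp add: R S_div ab_def bc_def ac_def mult_ac)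
qed

lemma general_position_nonzero:
  assumes "general_position n \<eta> x" "i \<in> {1..n}" "k \<in> {1..n}" "i \<noteq> k"
  shows "x i - x k \<noteq> 0" "x i - x k + \<eta> \<noteq> 0"
proof -
  have "x i \<noteq> x k" "x i \<noteq> x k - \<eta>" using assms unfolding general_position_def by blast+
  then show "x i - x k \<noteq> 0" "x i - x k + \<eta> \<noteq> 0" by (auto simp: algebra_simps)
qed

section \<open>Braided R-matrices and multiplication by a coordinate\<close>

definition braid_op :: "complex \<Rightarrow> nat \<Rightarrow> nat \<Rightarrow> complex \<Rightarrow> 'N tensor \<Rightarrow> 'N tensor" where
  "braid_op \<eta> a b w f = perm_op a b (R_op \<eta> a b w f)"

lemma braid_op_alt: "braid_op \<eta> a b w f = R_op \<eta> a b w (perm_op a b f)"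
  by (simp add: braid_op_def perm_op_R_op R_op_sym[of \<eta> b a])

lemma braid_op_sym: "braid_op \<eta> a b = braid_op \<eta> b a"
  by (simp add: braid_op_def R_op_sym[of \<eta> b a] perm_op_def transpose_commute[of b a] fun_eq_iff)

text \<open>In the braided form the sites stay in place and the parameters \<alpha> and \<beta>
  change places. This is what turns x into x' in the exchange lemmas.\<close>

lemma braid_Yang_Baxter:
  assumes "a \<noteq> b" "a \<noteq> c" "b \<noteq> c"
  shows "braid_op \<eta> a b (\<alpha> - \<beta>) (R_op \<eta> a c \<alpha> (R_op \<eta> b c \<beta> f))
       = R_op \<eta> a c \<beta> (R_op \<eta> b c \<alpha> (braid_op \<eta> a b (\<alpha> - \<beta>) f))"
  using assms by (simp add: braid_op_def Yang_Baxter perm_op_R_op)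

lemma braid_op_R_op_commute:
  assumes "i \<noteq> a" "i \<noteq> b" "k \<noteq> a" "k \<noteq> b"
  shows "braid_op \<eta> a b w (R_op \<eta> i k u f) = R_op \<eta> i k u (braid_op \<eta> a b w f)"
  using assms by (simp add: braid_op_def perm_op_R_op R_op_commute[of a i k b])

text \<open>Functions of z have type \<open>complex tensor\<close>, so \<open>perm_op\<close> and
  \<open>R_op\<close> act on them as they stand. Multiplication by the i-th coordinate is what g at
  site i becomes under transposition.\<close>

definition coord_mult :: "nat \<Rightarrow> complex tensor \<Rightarrow> complex tensor" where
  "coord_mult i f = (\<lambda>z. z i * f z)"

lemma perm_op_coord_mult: "perm_op a b (coord_mult i f) = coord_mult (swap a b i) (perm_op a b f)"
  by (simp add: perm_op_def coord_mult_def)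

lemma R_op_coord_mult:
  "j \<noteq> i \<Longrightarrow> j \<noteq> k \<Longrightarrow> R_op \<eta> i k u (coord_mult j f) = coord_mult j (R_op \<eta> i k u f)"
  by (simp add: R_op_def coord_mult_def perm_op_def fun_eq_iff algebra_simps)

lemma braid_op_coord_mult:
  "j \<noteq> a \<Longrightarrow> j \<noteq> b \<Longrightarrow> braid_op \<eta> a b w (coord_mult j f) = coord_mult j (braid_op \<eta> a b w f)"
  by (simp add: braid_op_def R_op_coord_mult perm_op_coord_mult)

lemma coord_mult_commute: "coord_mult i (coord_mult j f) = coord_mult j (coord_mult i f)"
  by (simp add: coord_mult_def fun_eq_iff)

text \<open>The factors \<open>h'\<close> may differ from \<open>h\<close>, since an exchange that
  passes through a product relabels sites or parameters.\<close>

lemma foldr_commute: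
  assumes "\<And>k f. k \<in> set ks \<Longrightarrow> Q (h k f) = h' k (Q f)"
  shows "Q (foldr h ks f) = foldr h' ks (Q f)"
  using assms by (induction ks) auto

section \<open>Transposed qKZ operators and their products\<close>

text \<open>
  The transpose of the part of the qKZ operator that survives the pairing with the sum of all
  basis covectors.
\<close>

definition right_op :: "complex \<Rightarrow> nat \<Rightarrow> (nat \<Rightarrow> complex) \<Rightarrow> nat \<Rightarrow> complex tensor \<Rightarrow> complex tensor" where
  "right_op \<eta> n x i f = foldr (\<lambda>k. R_op \<eta> i k (x i - x k)) [i+1..<n+1] (coord_mult i f)"

text \<open>The covector that belongs to I. The smallest index acts last because the shifts are
  removed from the largest index down; \<open>m\<close> cuts off the lower indices, for inductions
  on \<open>m\<close>.\<close>

definition right_prod :: "complex \<Rightarrow> nat \<Rightarrow> (nat \<Rightarrow> complex) \<Rightarrow> nat set \<Rightarrow> nat \<Rightarrow> complex tensor" where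
  "right_prod \<eta> n x I m = foldr (\<lambda>i f. if i \<in> I then right_op \<eta> n x i f else f) [m..<n+1] (\<lambda>z. 1)"

lemma right_prod_end [simp]: "n < m \<Longrightarrow> right_prod \<eta> n x I m = (\<lambda>z. 1)"
  by (simp add: right_prod_def)

lemma right_prod_step:
  "m \<le> n \<Longrightarrow> right_prod \<eta> n x I m = (if m \<in> I then right_op \<eta> n x m (right_prod \<eta> n x I (Suc m)) else right_prod \<eta> n x I (Suc m))"
  by (simp add: right_prod_def upt_conv_Cons del: upt_Suc)

lemma right_op_cong:
  assumes "\<And>k. i \<le> k \<Longrightarrow> k \<le> n \<Longrightarrow> x k = y k" "i \<le> n"
  shows "right_op \<eta> n x i f = right_op \<eta> n y i f"
  unfolding right_op_def using assms by (intro foldr_cong) auto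

lemma right_prod_cong:
  assumes "\<And>k. m \<le> k \<Longrightarrow> k \<le> n \<Longrightarrow> x k = y k" "\<And>k. m \<le> k \<Longrightarrow> k \<le> n \<Longrightarrow> k \<in> I \<longleftrightarrow> k \<in> I'"
  shows "right_prod \<eta> n x I m = right_prod \<eta> n y I' m"
  unfolding right_prod_def
proof (intro foldr_cong refl ext)
  fix i f z assume "i \<in> set [m..<n+1]"
  then show "(if i \<in> I then right_op \<eta> n x i f else f) z = (if i \<in> I' then right_op \<eta> n y i f else f) z"
    using assms right_op_cong[of i n x y \<eta> f] by auto
qed

lemma perm_op_right_op:
  assumes "a < i" "b < i" "i \<le> n"
  shows "perm_op a b (right_op \<eta> n x i f) = right_op \<eta> n x i (perm_op a b f)"
proof -
  have "perm_op a b (right_op \<eta> n x i f)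
      = foldr (\<lambda>k. R_op \<eta> i k (x i - x k)) [i+1..<n+1] (perm_op a b (coord_mult i f))"
    unfolding right_op_def using assms by (intro foldr_commute[where Q = "perm_op a b"]) (auto simp: perm_op_R_op)
  then show ?thesis using assms by (simp add: right_op_def perm_op_coord_mult)
qed

text \<open>Only sites from \<open>m\<close> on occur, so the function involves neither of the two
  exchanged variables. This symmetry is what makes the factors to the left of g disappear.\<close>

lemma perm_op_right_prod:
  assumes "a < m" "b < m"
  shows "perm_op a b (right_prod \<eta> n x I m) = right_prod \<eta> n x I m"
proof -
  have "perm_op a b (right_prod \<eta> n x I m)
      = foldr (\<lambda>i f. if i \<in> I then right_op \<eta> n x i f else f) [m..<n+1] (perm_op a b (\<lambda>z. 1))"
    unfolding right_prod_def using assms by (intro foldr_commute[where Q = "perm_op a b"]) (auto simp: perm_op_right_op)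
  then show ?thesis by (simp add: right_prod_def perm_op_def)
qed

section \<open>Exchanging two neighbouring parameters\<close>

text \<open>By unitarity the R-matrix inside the braid operator cancels the outermost factor of
  \<open>right_op\<close>, which couples i and i + 1. What remains is a permutation, and it renames
  site i to i + 1.\<close>

lemma braid_right_op_same:
  assumes "x' = x \<circ> swap i (Suc i)" "1 \<le> i" "i < n" "general_position n \<eta> x"
  shows "braid_op \<eta> i (Suc i) (x (Suc i) - x i) (right_op \<eta> n x i f)
       = right_op \<eta> n x' (Suc i) (perm_op i (Suc i) f)"
proof -
  define C where "C = foldr (\<lambda>k. R_op \<eta> i k (x i - x k)) [i+2..<n+1] (coord_mult i f)"
  have ne: "\<eta> + (x i - x (Suc i)) \<noteq> 0" "\<eta> - (x i - x (Suc i)) \<noteq> 0"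
    using assms(2,3) general_position_nonzero(2)[OF assms(4), of i "Suc i"]
      general_position_nonzero(2)[OF assms(4), of "Suc i" i] by (simp_all add: algebra_simps)
  have "right_op \<eta> n x i f = R_op \<eta> i (Suc i) (x i - x (Suc i)) C"
    using assms by (simp add: right_op_def C_def upt_conv_Cons del: upt_Suc)
  then have "braid_op \<eta> i (Suc i) (x (Suc i) - x i) (right_op \<eta> n x i f) = perm_op i (Suc i) C"
    using R_op_unitarity[OF ne, of i "Suc i" C] by (simp add: braid_op_def)
  also have "\<dots> = foldr (\<lambda>k. R_op \<eta> (Suc i) k (x' (Suc i) - x' k)) [i+2..<n+1]
      (perm_op i (Suc i) (coord_mult i f))"
    unfolding C_def using assms by (intro foldr_commute[where Q = "perm_op i (Suc i)"]) (auto simp: perm_op_R_op)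
  finally show ?thesis by (simp add: right_op_def perm_op_coord_mult del: upt_Suc)
qed

lemma perm_op_right_op_Suc:
  assumes "x' = x \<circ> swap i (Suc i)"
  shows "perm_op i (Suc i) (right_op \<eta> n x (Suc i) f)
       = foldr (\<lambda>k. R_op \<eta> i k (x' i - x' k)) [i+2..<n+1] (coord_mult i (perm_op i (Suc i) f))"
proof -
  have "perm_op i (Suc i) (right_op \<eta> n x (Suc i) f)
     = foldr (\<lambda>k. R_op \<eta> i k (x' i - x' k)) [Suc i+1..<n+1] (perm_op i (Suc i) (coord_mult (Suc i) f))"
    unfolding right_op_def using assms by (intro foldr_commute[where Q = "perm_op i (Suc i)"]) (auto simp: perm_op_R_op)
  then show ?thesis by (simp add: perm_op_coord_mult del: upt_Suc)
qed

text \<open>Here the permutation renames site i + 1 to i, and the R-matrix inside the braid operator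
  supplies the factor coupling i and i + 1 that \<open>right_op\<close> at i needs.\<close>

lemma braid_right_op_Suc:
  assumes "x' = x \<circ> swap i (Suc i)" "i < n"
  shows "braid_op \<eta> i (Suc i) (x (Suc i) - x i) (right_op \<eta> n x (Suc i) f)
       = right_op \<eta> n x' i (perm_op i (Suc i) f)"
proof -
  have "x' i = x (Suc i)" "x' (Suc i) = x i" using assms(1) by auto
  then have "right_op \<eta> n x' i h = R_op \<eta> i (Suc i) (x (Suc i) - x i)
      (foldr (\<lambda>k. R_op \<eta> i k (x' i - x' k)) [i+2..<n+1] (coord_mult i h))" for h
    using assms(2) by (simp add: right_op_def upt_conv_Cons del: upt_Suc)
  then show ?thesis
    by (simp only: braid_op_alt perm_op_right_op_Suc[OF assms(1)])
qed

text \<open>The factors at sites i and i + 1 are adjacent in the product, so the braid operator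
  passes them by the Yang-Baxter equation. It commutes with all the others.\<close>

lemma braid_right_op_lower:
  assumes "x' = x \<circ> swap i (Suc i)" "j < i" "i < n"
  shows "braid_op \<eta> i (Suc i) (x (Suc i) - x i) (right_op \<eta> n x j f)
       = right_op \<eta> n x' j (braid_op \<eta> i (Suc i) (x (Suc i) - x i) f)"
proof -
  let ?Q = "braid_op \<eta> i (Suc i) (x (Suc i) - x i)"
  let ?C = "\<lambda>x ks. foldr (\<lambda>k. R_op \<eta> j k (x j - x k)) ks"
  have "[j+1..<n+1] = [j+1..<i] @ [i..<n+1]"
    using assms upt_add_eq_append[of "j+1" i "n+1-i"] by simp
  also have "[i..<n+1] = [i, Suc i] @ [i+2..<n+1]"
    using assms by (simp add: upt_conv_Cons del: upt_Suc)
  finally have ivl: "[j+1..<n+1] = [j+1..<i] @ [i, Suc i] @ [i+2..<n+1]" .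
  have x': "x' j = x j" "x' i = x (Suc i)" "x' (Suc i) = x i" using assms by auto
  have comm: "?Q (?C x ks h) = ?C x' ks (?Q h)" if "set ks \<inter> {i, Suc i} = {}" for ks h
  proof (rule foldr_commute[where Q = "?Q"])
    fix k f assume "k \<in> set ks"
    then have "k \<noteq> i" "k \<noteq> Suc i" using that by auto
    then show "?Q (R_op \<eta> j k (x j - x k) f) = R_op \<eta> j k (x' j - x' k) (?Q f)"
      using assms(1,2) by (simp add: braid_op_R_op_commute)
  qed
  have mid: "?Q (?C x [i, Suc i] h) = ?C x' [i, Suc i] (?Q h)" for h
    using braid_Yang_Baxter[of i "Suc i" j \<eta> "x j - x i" "x j - x (Suc i)" h] assms(2)
    by (simp add: x' R_op_sym[of \<eta> j])
  have "?Q (right_op \<eta> n x j f) = ?Q (?C x [j+1..<i] (?C x [i, Suc i] (?C x [i+2..<n+1] (coord_mult j f))))"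
    by (simp only: right_op_def ivl foldr_append o_apply)
  also have "\<dots> = ?C x' [j+1..<i] (?C x' [i, Suc i] (?C x' [i+2..<n+1] (?Q (coord_mult j f))))"
    by (subst comm, simp, subst mid, subst comm) auto
  also have "?Q (coord_mult j f) = coord_mult j (?Q f)"
    using assms(2) by (simp add: braid_op_coord_mult)
  finally show ?thesis by (simp only: right_op_def ivl foldr_append o_apply)
qed

text \<open>R-matrices for (a, k) and (b, l) commute when k and l differ, so two products become a
  ladder whose rungs pair the factors with equal k. The Yang-Baxter equation then applies rung by
  rung.\<close>

lemma foldr_interleave:
  assumes "a \<noteq> b" "a \<notin> set ks" "b \<notin> set ks" "distinct ks"
  shows "foldr (\<lambda>k. R_op \<eta> a k (\<alpha> k)) ks (coord_mult a (foldr (\<lambda>k. R_op \<eta> b k (\<beta> k)) ks (coord_mult b h)))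
       = foldr (\<lambda>k f. R_op \<eta> a k (\<alpha> k) (R_op \<eta> b k (\<beta> k) f)) ks (coord_mult a (coord_mult b h))"
  using assms
proof (induction ks)
  case (Cons k ks)
  let ?A = "foldr (\<lambda>k. R_op \<eta> a k (\<alpha> k)) ks" and ?B = "foldr (\<lambda>k. R_op \<eta> b k (\<beta> k)) ks (coord_mult b h)"
  have "?A (coord_mult a (R_op \<eta> b k (\<beta> k) ?B)) = ?A (R_op \<eta> b k (\<beta> k) (coord_mult a ?B))"
    using Cons.prems by (simp add: R_op_coord_mult)
  also have "\<dots> = R_op \<eta> b k (\<beta> k) (?A (coord_mult a ?B))"
    using Cons.prems by (intro foldr_commute[where Q = "R_op \<eta> b k (\<beta> k)", symmetric] R_op_commute) auto
  finally show ?case using Cons by simp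
qed simp

text \<open>Both sides reduce to ladders over a function symmetric in the variables i and i + 1, and
  these differ by the exchange of two parameters, which the braid operator carries out.\<close>

lemma braid_right_op_both:
  assumes "x' = x \<circ> swap i (Suc i)" "1 \<le> i" "i < n" "general_position n \<eta> x"
    and h: "perm_op i (Suc i) h = h"
  shows "braid_op \<eta> i (Suc i) (x (Suc i) - x i) (right_op \<eta> n x i (right_op \<eta> n x (Suc i) h))
       = right_op \<eta> n x' i (right_op \<eta> n x' (Suc i) h)"
proof -
  let ?ks = "[Suc (Suc i)..<Suc n]" and ?P = "perm_op i (Suc i)"
  let ?Q = "braid_op \<eta> i (Suc i) (x (Suc i) - x i)"
  let ?E = "\<lambda>u v. foldr (\<lambda>k f. R_op \<eta> (Suc i) k (u - x k) (R_op \<eta> i k (v - x k) f)) ?ks"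
  let ?zz = "coord_mult (Suc i) (coord_mult i h)"
  have x': "x' i = x (Suc i)" "x' (Suc i) = x i" "\<And>k. k \<in> set ?ks \<Longrightarrow> x' k = x k"
    using assms by auto
  \<comment> \<open>The roles of x and x' are interchangeable, so both ladders arise from the same
    computation.\<close>
  have xx: "x = x' \<circ> swap i (Suc i)" using assms by (simp add: comp_assoc)
  have ne: "x (Suc i) - x i + \<eta> \<noteq> 0"
    using assms(2,3) by (intro general_position_nonzero[OF assms(4)]) auto
  have C: "foldr (\<lambda>k. R_op \<eta> a k (u - x' k)) ?ks = foldr (\<lambda>k. R_op \<eta> a k (u - x k)) ?ks" for a u
    by (intro ext foldr_cong) (simp_all add: x')
  have P1: "right_op \<eta> n x' (Suc i) (?P (right_op \<eta> n x (Suc i) h)) = ?E (x i) (x (Suc i)) ?zz"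
    unfolding perm_op_right_op_Suc[OF assms(1)] h
    unfolding right_op_def by (subst foldr_interleave[symmetric]) (simp_all add: x' C del: upt_Suc)
  have P2: "right_op \<eta> n x (Suc i) (?P (right_op \<eta> n x' (Suc i) h)) = ?E (x (Suc i)) (x i) ?zz"
    unfolding perm_op_right_op_Suc[OF xx] h
    unfolding right_op_def by (subst foldr_interleave[symmetric]) (simp_all add: x' C del: upt_Suc)
  have "?P ?zz = ?zz"
    using h by (simp add: perm_op_coord_mult coord_mult_commute[of i])
  then have Q: "?Q ?zz = ?zz" using ne by (simp add: braid_op_alt R_op_fixed)
  have "?Q (right_op \<eta> n x i (right_op \<eta> n x (Suc i) h)) = ?E (x i) (x (Suc i)) ?zz"
    by (simp add: braid_right_op_same[OF assms(1-4)] P1)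
  \<comment> \<open>The braid operator can be inserted for free at the symmetric function; moving it
    outwards through the ladder then swaps the parameters.\<close>
  also have "\<dots> = ?E (x i) (x (Suc i)) (?Q ?zz)" by (simp add: Q)
  also have "\<dots> = ?Q (?E (x (Suc i)) (x i) ?zz)"
  proof (rule foldr_commute[where Q = "?Q", symmetric])
    fix k f assume "k \<in> set ?ks"
    then have "Suc i \<noteq> k" "i \<noteq> k" by auto
    then show "?Q (R_op \<eta> (Suc i) k (x (Suc i) - x k) (R_op \<eta> i k (x i - x k) f))
       = R_op \<eta> (Suc i) k (x i - x k) (R_op \<eta> i k (x (Suc i) - x k) (?Q f))"
      using braid_Yang_Baxter[of "Suc i" i k \<eta> "x (Suc i) - x k" "x i - x k" f]
      by (simp add: braid_op_sym[of \<eta> "Suc i"])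
  qed
  also have "\<dots> = ?Q (right_op \<eta> n x (Suc i) (?P (right_op \<eta> n x' (Suc i) h)))" by (simp only: P2)
  also have "\<dots> = right_op \<eta> n x' i (right_op \<eta> n x' (Suc i) h)"
    using assms(1,3) by (simp add: braid_right_op_Suc)
  finally show ?thesis .
qed

text \<open>Factors of index above i + 1 do not notice the exchange, those at i and i + 1 give four
  cases according to membership in I, and the braid operator passes through those of lower
  index.\<close>

lemma right_prod_exchange:
  assumes "x' = x \<circ> swap i (Suc i)" "1 \<le> i" "i < n" "general_position n \<eta> x"
  shows "right_prod \<eta> n x' (swap i (Suc i) ` I) 1
       = braid_op \<eta> i (Suc i) (x (Suc i) - x i) (right_prod \<eta> n x I 1)"
proof -
  define I' where "I' = swap i (Suc i) ` I"
  let ?Q = "braid_op \<eta> i (Suc i) (x (Suc i) - x i)" and ?P = "perm_op i (Suc i)"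
  define h where "h = right_prod \<eta> n x I (i+2)"
  have mem: "k \<in> I' \<longleftrightarrow> swap i (Suc i) k \<in> I" for k
    unfolding I'_def by (metis image_iff transpose_involutory)
  have h': "right_prod \<eta> n x' I' (i+2) = h"
    unfolding h_def by (rule right_prod_cong) (auto simp: assms mem)
  have Ph: "?P h = h" unfolding h_def by (rule perm_op_right_prod) auto
  have ne: "x (Suc i) - x i + \<eta> \<noteq> 0"
    using assms(2,3) by (intro general_position_nonzero[OF assms(4)]) auto
  have Qh: "?Q h = h" using ne Ph by (simp add: braid_op_alt R_op_fixed)
  have "right_prod \<eta> n x' I' i = ?Q (right_prod \<eta> n x I i)"
  proof -
    have r: "right_prod \<eta> n x I i = (let r = if Suc i \<in> I then right_op \<eta> n x (Suc i) h else h in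
        if i \<in> I then right_op \<eta> n x i r else r)"
      using assms(3) by (simp add: right_prod_step[of i] right_prod_step[of "Suc i"] h_def)
    have r': "right_prod \<eta> n x' I' i = (let r = if i \<in> I then right_op \<eta> n x' (Suc i) h else h in
        if Suc i \<in> I then right_op \<eta> n x' i r else r)"
      using assms(3) h' by (simp add: right_prod_step[of i] right_prod_step[of "Suc i"] mem)
    show ?thesis
      unfolding r r' using braid_right_op_both[OF assms Ph] Ph Qh
        braid_right_op_same[OF assms] braid_right_op_Suc[OF assms(1,3)]
      by (auto simp: Let_def)
  qed
  moreover have ivl: "[1..<n+1] = [1..<i] @ [i..<n+1]"
    using assms upt_add_eq_append[of 1 i "n+1-i"] by simp
  moreover have "foldr (\<lambda>j f. if j \<in> I' then right_op \<eta> n x' j f else f) [1..<i] (?Q f)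
      = ?Q (foldr (\<lambda>j f. if j \<in> I then right_op \<eta> n x j f else f) [1..<i] f)" for f
    by (rule foldr_commute[where Q = "?Q", symmetric])
      (use assms in \<open>auto simp: mem braid_right_op_lower Transposition.transpose_def\<close>)
  ultimately show ?thesis
    by (simp only: right_prod_def I'_def[symmetric] ivl foldr_append o_apply)
qed

subsection \<open>Multilinear forms and normalization\<close>

definition multilinear_form :: "nat set \<Rightarrow> nat \<Rightarrow> complex tensor \<Rightarrow> bool" where
  "multilinear_form A d f \<longleftrightarrow>
     (\<exists>a. \<forall>z. f z = (\<Sum>S | S \<subseteq> A \<and> card S = d. a S * (\<Prod>k\<in>S. z k)))"

lemma multilinear_formI:
  "(\<And>z. f z = (\<Sum>S | S \<subseteq> A \<and> card S = d. a S * (\<Prod>k\<in>S. z k))) \<Longrightarrow> multilinear_form A d f"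
  unfolding multilinear_form_def by blast

lemma multilinear_form_zero: "multilinear_form A d (\<lambda>z. 0)"
  unfolding multilinear_form_def by (rule exI[of _ "\<lambda>_. 0"]) simp

lemma multilinear_form_add:
  assumes "multilinear_form A d f" "multilinear_form A d h"
  shows "multilinear_form A d (\<lambda>z. f z + h z)"
proof -
  obtain a b where "\<forall>z. f z = (\<Sum>S | S \<subseteq> A \<and> card S = d. a S * (\<Prod>k\<in>S. z k))"
    "\<forall>z. h z = (\<Sum>S | S \<subseteq> A \<and> card S = d. b S * (\<Prod>k\<in>S. z k))"
    using assms unfolding multilinear_form_def by auto
  then show ?thesis unfolding multilinear_form_def
    by (intro exI[of _ "\<lambda>S. a S + b S"]) (simp add: distrib_right sum.distrib)
qed

lemma multilinear_form_scale:
  assumes "multilinear_form A d f"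
  shows "multilinear_form A d (\<lambda>z. c * f z)"
proof -
  obtain a where "\<forall>z. f z = (\<Sum>S | S \<subseteq> A \<and> card S = d. a S * (\<Prod>k\<in>S. z k))"
    using assms unfolding multilinear_form_def by auto
  then show ?thesis unfolding multilinear_form_def
    by (intro exI[of _ "\<lambda>S. c * a S"]) (simp add: sum_distrib_left mult.assoc)
qed

lemma multilinear_form_sum:
  assumes "\<And>i. i \<in> B \<Longrightarrow> multilinear_form A d (f i)"
  shows "multilinear_form A d (\<lambda>z. \<Sum>i\<in>B. f i z)"
  using assms
  by (induction B rule: infinite_finite_induct) (auto intro: multilinear_form_zero multilinear_form_add)

lemma multilinear_form_perm_op:
  assumes "multilinear_form A d f" "i \<in> A" "k \<in> A"
  shows "multilinear_form A d (perm_op i k f)"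
proof -
  obtain a where a: "\<And>z. f z = (\<Sum>S | S \<subseteq> A \<and> card S = d. a S * (\<Prod>k\<in>S. z k))"
    using assms unfolding multilinear_form_def by auto
  let ?t = "swap i k"
  have img: "?t ` S \<subseteq> A" if "S \<subseteq> A" for S
    using that assms(2,3) by (auto simp: Transposition.transpose_def)
  have "perm_op i k f z = (\<Sum>S | S \<subseteq> A \<and> card S = d. a (?t ` S) * (\<Prod>k\<in>S. z k))" for z
  proof -
    have "perm_op i k f z = (\<Sum>S | S \<subseteq> A \<and> card S = d. a S * (\<Prod>k\<in>S. z (?t k)))"
      by (simp add: perm_op_def a)
    also have "\<dots> = (\<Sum>S | S \<subseteq> A \<and> card S = d. a (?t ` S) * (\<Prod>k\<in>S. z k))"
      by (rule sum.reindex_bij_witness[of _ "\<lambda>S. ?t ` S" "\<lambda>S. ?t ` S"])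
        (use img in \<open>auto simp: image_comp card_image prod.reindex\<close>)
    finally show ?thesis .
  qed
  then show ?thesis by (rule multilinear_formI)
qed

lemma multilinear_form_R_op:
  assumes "multilinear_form A d f" "i \<in> A" "k \<in> A"
  shows "multilinear_form A d (R_op \<eta> i k u f)"
proof -
  have "R_op \<eta> i k u f = (\<lambda>z. u / (u + \<eta>) * f z + \<eta> / (u + \<eta>) * perm_op i k f z)"
    by (simp add: R_op_def add_divide_distrib)
  then show ?thesis
    using assms by (simp only:) (intro multilinear_form_add multilinear_form_scale multilinear_form_perm_op)
qed

lemma multilinear_form_mono:
  assumes "multilinear_form A d f" "A \<subseteq> B" "finite B"
  shows "multilinear_form B d f"
proof -
  obtain a where a: "\<And>z. f z = (\<Sum>S | S \<subseteq> A \<and> card S = d. a S * (\<Prod>k\<in>S. z k))"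
    using assms unfolding multilinear_form_def by auto
  have "f z = (\<Sum>S | S \<subseteq> B \<and> card S = d. (if S \<subseteq> A then a S else 0) * (\<Prod>k\<in>S. z k))" for z
    unfolding a using assms(2,3) by (intro sum.mono_neutral_cong_left) auto
  then show ?thesis by (rule multilinear_formI)
qed

text \<open>Monomials stay squarefree because the variable is new; deleting i matches the sets that
  contain i with the subsets of A.\<close>

lemma multilinear_form_coord_mult:
  assumes "multilinear_form A d f" "i \<notin> A" "finite A"
  shows "multilinear_form (insert i A) (Suc d) (coord_mult i f)"
proof -
  obtain a where a: "\<And>z. f z = (\<Sum>S | S \<subseteq> A \<and> card S = d. a S * (\<Prod>k\<in>S. z k))"
    using assms unfolding multilinear_form_def by auto
  have "coord_mult i f z = (\<Sum>S | S \<subseteq> insert i A \<and> card S = Suc d.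
      (if i \<in> S then a (S - {i}) else 0) * (\<Prod>k\<in>S. z k))" for z
  proof -
    have fin: "finite S" if "S \<subseteq> insert i A" for S
      using that assms(3) finite_subset by blast
    have "(\<Sum>S | S \<subseteq> insert i A \<and> card S = Suc d. (if i \<in> S then a (S - {i}) else 0) * (\<Prod>k\<in>S. z k))
       = (\<Sum>S | S \<subseteq> insert i A \<and> card S = Suc d \<and> i \<in> S. a (S - {i}) * (\<Prod>k\<in>S. z k))"
      using assms(3) by (intro sum.mono_neutral_cong_right) auto
    also have "\<dots> = (\<Sum>S | S \<subseteq> A \<and> card S = d. z i * (a S * (\<Prod>k\<in>S. z k)))"
      by (rule sum.reindex_bij_witness[of _ "insert i" "\<lambda>S. S - {i}"])
        (use assms(2) fin in \<open>auto simp: card_insert_if finite_subset[OF _ assms(3)] prod.remove mult.left_commute\<close>)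
    finally show ?thesis by (simp add: coord_mult_def a sum_distrib_left)
  qed
  then show ?thesis by (rule multilinear_formI)
qed

lemma multilinear_form_const: "multilinear_form {} 0 (\<lambda>z. 1)"
proof -
  have "{S. S \<subseteq> ({}::nat set) \<and> card S = 0} = {{}}" by auto
  then show ?thesis unfolding multilinear_form_def by (intro exI[of _ "\<lambda>_. 1"]) simp
qed

lemma foldr_invariant:
  assumes "P f" "\<And>k f. k \<in> set ks \<Longrightarrow> P f \<Longrightarrow> P (h k f)"
  shows "P (foldr h ks f)"
  using assms by (induction ks) auto

text \<open>Each \<open>right_op\<close> at m multiplies by a variable absent from the factors of
  higher index, and then only mixes permutations of the variables from m to n.\<close>

lemma multilinear_form_right_prod:
  "multilinear_form {m..n} (card (I \<inter> {m..n})) (right_prod \<eta> n x I m)"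
proof (cases "m \<le> n")
  case True
  then have "m \<le> Suc n" by simp
  then show ?thesis
  proof (induction m rule: inc_induct)
    case base
    show ?case by (simp add: multilinear_form_const)
  next
    case (step m)
    let ?f = "right_prod \<eta> n x I (Suc m)"
    have eq: "{m..n} = insert m {Suc m..n}" using step by auto
    show ?case
    proof (cases "m \<in> I")
      case True
      have "multilinear_form {m..n} (Suc (card (I \<inter> {Suc m..n}))) (right_op \<eta> n x m ?f)"
        unfolding right_op_def
      proof (rule foldr_invariant[where P = "multilinear_form {m..n} (Suc (card (I \<inter> {Suc m..n})))"])
        show "multilinear_form {m..n} (Suc (card (I \<inter> {Suc m..n}))) (coord_mult m ?f)"
          unfolding eq using step by (intro multilinear_form_coord_mult) auto
      qed (use step in \<open>auto intro!: multilinear_form_R_op\<close>)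
      then show ?thesis using True step eq by (simp add: right_prod_step)
    next
      case False
      then show ?thesis
        using step eq by (auto simp: right_prod_step intro: multilinear_form_mono)
    qed
  qed
qed (simp add: multilinear_form_const)

text \<open>The value at the indicator of S is the coefficient at S: any other T of the same size
  has an element outside S, which kills its monomial.\<close>

lemma multilinear_form_eqI:
  assumes "multilinear_form A d f" "finite A"
    and "\<And>S. S \<subseteq> A \<Longrightarrow> card S = d \<Longrightarrow> f (\<lambda>k. of_bool (k \<in> S)) = 1"
  shows "f = elem_sym d A"
proof
  fix z
  obtain a where a: "\<And>z. f z = (\<Sum>S | S \<subseteq> A \<and> card S = d. a S * (\<Prod>k\<in>S. z k))"
    using assms unfolding multilinear_form_def by auto
  have "a S = 1" if S: "S \<subseteq> A" "card S = d" for S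
  proof -
    have "(\<Prod>k\<in>T. of_bool (k \<in> S)) = (of_bool (T = S) :: complex)" if "T \<subseteq> A" "card T = d" for T
    proof (cases "T \<subseteq> S")
      case True
      then have "T = S" using S that assms(2) by (metis card_subset_eq finite_subset)
      then show ?thesis by simp
    next
      case False
      then have "(\<Prod>k\<in>T. of_bool (k \<in> S)) = (0::complex)"
        using that assms(2) finite_subset by (intro prod_zero) auto
      then show ?thesis using False by auto
    qed
    then have "f (\<lambda>k. of_bool (k \<in> S)) = (\<Sum>T | T \<subseteq> A \<and> card T = d. a T * of_bool (T = S))"
      unfolding a by (intro sum.cong) auto
    also have "\<dots> = (\<Sum>T\<in>{S}. a T)"
      using S assms(2) by (intro sum.mono_neutral_cong_right) auto
    finally show ?thesis using assms(3)[OF S] by simp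
  qed
  then show "f z = elem_sym d A z" by (simp add: a elem_sym_def)
qed


section \<open>The coefficient at the first d variables\<close>

text \<open>
  A monomial in \<open>right_prod \<eta> n x I 1\<close> has at least as many factors \<open>z k\<close> with \<open>k > d\<close> as \<open>I\<close> has
  elements \<open>k > d\<close>; only the case of a positive number of such factors is needed.
\<close>

definition vanishing :: "nat \<Rightarrow> nat \<Rightarrow> complex tensor \<Rightarrow> bool" where
  "vanishing d n f \<longleftrightarrow> (\<forall>z. (\<forall>k\<in>{d<..n}. z k = 0) \<longrightarrow> f z = 0)"

lemma vanishing_R_op:
  assumes "vanishing d n f" "i \<in> {d<..n} \<longleftrightarrow> k \<in> {d<..n}"
  shows "vanishing d n (R_op \<eta> i k u f)"
  unfolding vanishing_def
proof (intro allI impI)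
  fix z :: "nat \<Rightarrow> complex" assume z: "\<forall>k\<in>{d<..n}. z k = 0"
  have "(z \<circ> swap i k) j = 0" if "j \<in> {d<..n}" for j
  proof -
    have "swap i k j \<in> {d<..n}" using assms(2) that by (metis transpose_eq_iff)
    then show ?thesis using z by simp
  qed
  then have "f (z \<circ> swap i k) = 0" "f z = 0" using assms(1) z unfolding vanishing_def by blast+
  then show "R_op \<eta> i k u f z = 0" by (simp add: R_op_def perm_op_def)
qed

text \<open>The factor \<open>z i\<close> has i > d, and every R-matrix applied to it exchanges two
  sites above d.\<close>

lemma vanishing_right_op_gt:
  assumes "d < i" "i \<le> n"
  shows "vanishing d n (right_op \<eta> n x i f)"
  unfolding right_op_def
proof (rule foldr_invariant[where P = "vanishing d n"])
  fix k f assume "k \<in> set [i+1..<n+1]" "vanishing d n f"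
  then show "vanishing d n (R_op \<eta> i k (x i - x k) f)"
    using assms by (intro vanishing_R_op) auto
qed (use assms in \<open>auto simp: vanishing_def coord_mult_def\<close>)

lemma right_op_split:
  assumes "i \<le> d" "d \<le> n"
  shows "right_op \<eta> n x i f = foldr (\<lambda>k. R_op \<eta> i k (x i - x k)) [i+1..<d+1]
           (foldr (\<lambda>k. R_op \<eta> i k (x i - x k)) [d+1..<n+1] (coord_mult i f))"
proof -
  have "[i+1..<n+1] = [i+1..<d+1] @ [d+1..<n+1]"
    using assms upt_add_eq_append[of "i+1" "d+1" "n-d"] by simp
  then show ?thesis by (simp only: right_op_def foldr_append o_apply)
qed

lemma vanishing_right_op_le:
  assumes "i \<le> d" "d \<le> n" "vanishing d n f"
  shows "vanishing d n (right_op \<eta> n x i f)"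
  unfolding right_op_split[OF assms(1,2)]
proof (rule foldr_invariant[where P = "vanishing d n"])
  \<comment> \<open>An exchange of i with some k > d does not respect \<open>vanishing\<close>. The
    property \<open>P\<close>, vanishing whenever at most one coordinate in i and d+1, ..., n is
    nonzero, is symmetric in all these sites.\<close>
  define P where "P f \<longleftrightarrow> (\<forall>z p. (\<forall>k\<in>insert i {d<..n}. k \<noteq> p \<longrightarrow> z k = 0) \<longrightarrow> f z = 0)"
    for f :: "complex tensor"
  have "P (foldr (\<lambda>k. R_op \<eta> i k (x i - x k)) [d+1..<n+1] (coord_mult i f))"
  proof (rule foldr_invariant[where P = P])
    show "P (coord_mult i f)"
      unfolding P_def
    proof (intro allI impI)
      fix z :: "nat \<Rightarrow> complex" and p assume z: "\<forall>k\<in>insert i {d<..n}. k \<noteq> p \<longrightarrow> z k = 0"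
      show "coord_mult i f z = 0"
      proof (cases "p = i")
        case True
        then show ?thesis using z assms by (auto simp: vanishing_def coord_mult_def)
      qed (use z in \<open>auto simp: coord_mult_def\<close>)
    qed
  next
    fix k f assume k: "k \<in> set [d+1..<n+1]" and f: "P f"
    show "P (R_op \<eta> i k (x i - x k) f)"
      unfolding P_def
    proof (intro allI impI)
      fix z :: "nat \<Rightarrow> complex" and p assume z: "\<forall>k\<in>insert i {d<..n}. k \<noteq> p \<longrightarrow> z k = 0"
      then have "\<forall>j\<in>insert i {d<..n}. j \<noteq> swap i k p \<longrightarrow> (z \<circ> swap i k) j = 0"
        using k by (auto simp: Transposition.transpose_def split: if_splits)
      then have "f (z \<circ> swap i k) = 0" "f z = 0" using f z unfolding P_def by blast+
      then show "R_op \<eta> i k (x i - x k) f z = 0" by (simp add: R_op_def perm_op_def)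
    qed
  qed
  \<comment> \<open>The choice p = i leaves the coordinate at i free, which is the required
    vanishing.\<close>
  then show "vanishing d n (foldr (\<lambda>k. R_op \<eta> i k (x i - x k)) [d+1..<n+1] (coord_mult i f))"
    unfolding P_def vanishing_def using assms(1) by fastforce
next
  fix k f assume "k \<in> set [i+1..<d+1]" "vanishing d n f"
  then show "vanishing d n (R_op \<eta> i k (x i - x k) f)"
    using assms by (intro vanishing_R_op) auto
qed

lemma vanishing_right_prod:
  assumes "i \<in> I" "d < i" "i \<le> n" "m \<le> i"
  shows "vanishing d n (right_prod \<eta> n x I m)"
  using assms(4)
proof (induction m rule: inc_induct)
  case base
  then show ?case using assms by (simp add: right_prod_step vanishing_right_op_gt)
next
  case (step m)
  then show ?case using assms
    by (cases "d < m") (auto simp: right_prod_step vanishing_right_op_gt vanishing_right_op_le)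
qed

text \<open>R-matrices with k \<le> d exchange two coordinates equal to 1 and act as the identity.
  For k > d the exchanged term has a zero at site i and drops out, so only the factor u / (u +
  \<eta>) is left.\<close>

lemma right_op_packed:
  fixes f :: "complex tensor"
  assumes "1 \<le> i" "i \<le> d" "d \<le> n" "general_position n \<eta> x"
    and z: "\<And>k. i \<le> k \<Longrightarrow> k \<le> d \<Longrightarrow> z k = 1" "\<And>k. d < k \<Longrightarrow> k \<le> n \<Longrightarrow> z k = 0"
  shows "right_op \<eta> n x i f z = (\<Prod>k\<in>{d<..n}. (x i - x k) / (x i - x k + \<eta>)) * f z"
proof -
  define C where "C m = foldr (\<lambda>k. R_op \<eta> i k (x i - x k)) [m..<n+1] (coord_mult i f)" for m
  have C_step: "C m = R_op \<eta> i m (x i - x m) (C (Suc m))" if "m \<le> n" for m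
    using that by (simp add: C_def upt_conv_Cons del: upt_Suc)
  \<comment> \<open>The claim covers all such y because the induction also evaluates at the
    exchanged point, whose coordinate at i is 0.\<close>
  have C: "C m y = (if y i = 0 then 0 else \<Prod>k\<in>{m..n}. (x i - x k) / (x i - x k + \<eta>)) * (y i * f y)"
    if "d < m" "m \<le> Suc n" and y: "\<And>k. m \<le> k \<Longrightarrow> k \<le> n \<Longrightarrow> y k = 0" for m y
    using that(2,1) y
  proof (induction m arbitrary: y rule: inc_induct)
    case base
    show ?case by (simp add: C_def coord_mult_def)
  next
    case (step m)
    have "{m..n} = insert m {Suc m..n}" using step.hyps by auto
    then have prod: "(\<Prod>k\<in>{m..n}. h k) = h m * (\<Prod>k\<in>{Suc m..n}. h k)" for h :: "nat \<Rightarrow> complex"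
      by simp
    have "C (Suc m) (y \<circ> swap i m) = 0"
      using step.prems step.hyps assms(2) by (subst step.IH) (auto simp: Transposition.transpose_def)
    then have "C m y = (x i - x m) / (x i - x m + \<eta>) * C (Suc m) y"
      using step.hyps by (simp add: C_step R_op_def perm_op_def)
    then show ?case using step by (simp add: prod)
  qed
  have low: "foldr (\<lambda>k. R_op \<eta> i k (x i - x k)) ks h z = h z"
    if "\<And>k. k \<in> set ks \<Longrightarrow> i < k \<and> k \<le> d" for ks h
    using that
  proof (induction ks)
    case (Cons k ks)
    have "z \<circ> swap i k = z" using z(1)[of k] z(1)[of i] Cons.prems[of k] assms(2)
      by (auto simp: fun_eq_iff Transposition.transpose_def)
    moreover have "x i - x k + \<eta> \<noteq> 0"
      using assms(1-3) Cons.prems[of k] by (intro general_position_nonzero[OF assms(4)]) auto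
    ultimately show ?case using Cons by (simp add: R_op_def perm_op_def flip: distrib_right)
  qed simp
  have "right_op \<eta> n x i f z = C (d+1) z"
    unfolding right_op_split[OF assms(2,3)] C_def by (rule low) auto
  also have "\<dots> = (\<Prod>k\<in>{d<..n}. (x i - x k) / (x i - x k + \<eta>)) * f z"
    using assms(2,3) z by (subst C) (auto simp: atLeastSucAtMost_greaterThanAtMost)
  finally show ?thesis .
qed

lemma right_prod_packed:
  assumes "1 \<le> m" "m \<le> Suc d" "d \<le> n" "general_position n \<eta> x"
    and "\<And>k. m \<le> k \<Longrightarrow> k \<le> d \<Longrightarrow> z k = 1" "\<And>k. d < k \<Longrightarrow> k \<le> n \<Longrightarrow> z k = 0"
  shows "right_prod \<eta> n x {1..d} m z = (\<Prod>i\<in>{m..d}. \<Prod>k\<in>{d<..n}. (x i - x k) / (x i - x k + \<eta>))"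
  using assms(2,1,5)
proof (induction m rule: inc_induct)
  case base
  have "right_prod \<eta> n x {1..d} (Suc d) = right_prod \<eta> n x {} (Suc d)"
    by (rule right_prod_cong) auto
  moreover have "right_prod \<eta> n x {} k = (\<lambda>z. 1)" for k
    unfolding right_prod_def by (rule foldr_invariant[where P = "\<lambda>f. f = (\<lambda>z. 1)"]) auto
  ultimately show ?case by simp
next
  case (step m)
  then have "{m..d} = insert m {Suc m..d}" by auto
  moreover have "right_op \<eta> n x m f z = (\<Prod>k\<in>{d<..n}. (x m - x k) / (x m - x k + \<eta>)) * f z" for f
    using step assms(3,4,6) by (intro right_op_packed) auto
  ultimately show ?case
    using step assms(3) by (simp add: right_prod_step)
qed

section \<open>The weighted sum over I\<close>

definition weight :: "complex \<Rightarrow> nat \<Rightarrow> (nat \<Rightarrow> complex) \<Rightarrow> nat set \<Rightarrow> complex" where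
  "weight \<eta> n x I = (\<Prod>s\<in>I. \<Prod>r\<in>{1..n} - I. (x s - x r + \<eta>) / (x s - x r))"

text \<open>The function F_x: its pairing with the solution is the Hamiltonian applied to
  \<Psi>.\<close>

definition right_sum :: "complex \<Rightarrow> nat \<Rightarrow> nat \<Rightarrow> (nat \<Rightarrow> complex) \<Rightarrow> complex tensor" where
  "right_sum \<eta> n d x = (\<lambda>z. \<Sum>I | I \<subseteq> {1..n} \<and> card I = d. weight \<eta> n x I * right_prod \<eta> n x I 1 z)"

lemma right_sum_packed:
  assumes "d \<le> n" "general_position n \<eta> x"
  shows "right_sum \<eta> n d x (\<lambda>k. of_bool (k \<in> {1..d})) = 1"
proof -
  let ?z = "\<lambda>k. of_bool (k \<in> {1..d}) :: complex"
  have "right_prod \<eta> n x I 1 ?z = 0" if I: "I \<subseteq> {1..n}" "card I = d" "I \<noteq> {1..d}" for I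
  proof -
    \<comment> \<open>A set of size d other than {1..d} must contain an element above d, so its term
      vanishes at this point.\<close>
    have "\<not> I \<subseteq> {1..d}" using I by (metis card_atLeastAtMost card_subset_eq diff_Suc_1 finite_atLeastAtMost)
    then obtain i where "i \<in> I" "d < i" "1 \<le> i" "i \<le> n" using I by fastforce
    then have "vanishing d n (right_prod \<eta> n x I 1)" by (intro vanishing_right_prod)
    then show ?thesis by (simp add: vanishing_def)
  qed
  then have "right_sum \<eta> n d x ?z = (\<Sum>I\<in>{{1..d}}. weight \<eta> n x I * right_prod \<eta> n x I 1 ?z)"
    unfolding right_sum_def using assms(1) by (intro sum.mono_neutral_right) auto
  also have "\<dots> = weight \<eta> n x {1..d} * (\<Prod>i\<in>{1..d}. \<Prod>k\<in>{d<..n}. (x i - x k) / (x i - x k + \<eta>))"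
    using assms right_prod_packed[of 1 d n \<eta> x ?z] by simp
  also have "{1..n} - {1..d} = {d<..n}" by auto
  then have "weight \<eta> n x {1..d} * (\<Prod>i\<in>{1..d}. \<Prod>k\<in>{d<..n}. (x i - x k) / (x i - x k + \<eta>))
    = (\<Prod>i\<in>{1..d}. \<Prod>k\<in>{d<..n}. (x i - x k + \<eta>) / (x i - x k) * ((x i - x k) / (x i - x k + \<eta>)))"
    by (simp add: weight_def flip: prod.distrib)
  also have "\<dots> = 1"
  proof (intro prod.neutral ballI)
    fix i k assume "i \<in> {1..d}" "k \<in> {d<..n}"
    then have "i \<in> {1..n}" "k \<in> {1..n}" "i \<noteq> k" using assms(1) by auto
    then have "x i - x k + \<eta> \<noteq> 0" "x i - x k \<noteq> 0"
      by (fact general_position_nonzero[OF assms(2)])+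
    then show "(x i - x k + \<eta>) / (x i - x k) * ((x i - x k) / (x i - x k + \<eta>)) = 1" by simp
  qed
  finally show ?thesis .
qed

text \<open>The weight is unchanged when x and I are permuted together. Reindexing the sum by the
  image of I therefore reduces the claim to the single terms, by linearity of the braid
  operator.\<close>

lemma right_sum_exchange:
  assumes "x' = x \<circ> swap i (Suc i)" "1 \<le> i" "i < n" "general_position n \<eta> x"
  shows "right_sum \<eta> n d x' = braid_op \<eta> i (Suc i) (x (Suc i) - x i) (right_sum \<eta> n d x)"
proof
  fix z :: "nat \<Rightarrow> complex"
  let ?t = "swap i (Suc i)" and ?Q = "braid_op \<eta> i (Suc i) (x (Suc i) - x i)"
  let ?S = "{I. I \<subseteq> {1..n} \<and> card I = d}"
  have tn: "?t ` {1..n} = {1..n}" using assms(2,3) by (intro transpose_image_eq) auto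
  have w: "weight \<eta> n x' (?t ` I) = weight \<eta> n x I" for I
  proof -
    have "{1..n} - ?t ` I = ?t ` ({1..n} - I)" using tn by (simp add: image_set_diff)
    then show ?thesis by (simp add: weight_def assms(1) prod.reindex)
  qed
  have Q: "?Q f z = ((x (Suc i) - x i) * f (z \<circ> ?t) + \<eta> * f z) / (x (Suc i) - x i + \<eta>)" for f
    by (simp add: braid_op_def R_op_def perm_op_def comp_assoc)
  have "right_sum \<eta> n d x' z = (\<Sum>I\<in>?S. weight \<eta> n x' (?t ` I) * right_prod \<eta> n x' (?t ` I) 1 z)"
    unfolding right_sum_def
    by (rule sum.reindex_bij_witness[of _ "\<lambda>I. ?t ` I" "\<lambda>I. ?t ` I"])
      (use tn in \<open>auto simp: image_comp card_image\<close>)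
  also have "\<dots> = (\<Sum>I\<in>?S. weight \<eta> n x I * ?Q (right_prod \<eta> n x I 1) z)"
    by (simp only: w right_prod_exchange[OF assms])
  also have "\<dots> = ?Q (right_sum \<eta> n d x) z"
    by (simp add: Q right_sum_def sum_distrib_left sum.distrib[symmetric] sum_divide_distrib[symmetric])
      (simp add: algebra_simps)
  finally show "right_sum \<eta> n d x' z = ?Q (right_sum \<eta> n d x) z" .
qed

lemma general_position_swap:
  assumes "general_position n \<eta> x" "1 \<le> i" "i < n"
  shows "general_position n \<eta> (x \<circ> swap i (Suc i))"
proof -
  have "swap i (Suc i) k \<in> {1..n}" if "k \<in> {1..n}" for k
    using that assms(2,3) by (auto simp: Transposition.transpose_def)
  then show ?thesis using assms(1) unfolding general_position_def
    by (metis comp_apply transpose_involutory)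
qed

text \<open>Induction on the sum of the elements of S: replacing i + 1 by i lowers it, and the sets
  admitting no such move are the initial segments. The induction needs all x, since the exchange
  changes the point.\<close>

lemma right_sum_indicator:
  assumes "S \<subseteq> {1..n}" "card S = d" "general_position n \<eta> x"
  shows "right_sum \<eta> n d x (\<lambda>k. of_bool (k \<in> S)) = 1"
  using assms
proof (induction "\<Sum>S" arbitrary: S x rule: less_induct)
  case less
  have fin: "finite S" using less.prems finite_subset by blast
  have dn: "d \<le> n" using less.prems card_mono[of "{1..n}" S] by simp
  show ?case
  proof (cases "\<exists>i\<ge>1. i \<notin> S \<and> Suc i \<in> S")
    case True
    then obtain i where i: "1 \<le> i" "i \<notin> S" "Suc i \<in> S" by blast
    then have "i < n" using less.prems by auto
    define S' where "S' = insert i (S - {Suc i})"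
    let ?x = "x \<circ> swap i (Suc i)" and ?u = "x (Suc i) - x i"
    have "\<Sum>S = Suc i + \<Sum>(S - {Suc i})" using i fin by (simp add: sum.remove)
    then have lt: "\<Sum>S' < \<Sum>S" using i fin by (simp add: S'_def)
    have S': "S' \<subseteq> {1..n}" "card S' = d"
      using i(1,2) \<open>i < n\<close> less.prems(1,2) fin card.remove[OF fin i(3)] unfolding S'_def
      by (fastforce, simp)
    have ind: "(\<lambda>k. of_bool (k \<in> S')) \<circ> swap i (Suc i) = (\<lambda>k. of_bool (k \<in> S) :: complex)"
      using i(2,3) by (simp add: S'_def fun_eq_iff Transposition.transpose_def)
    have ne: "?u + \<eta> \<noteq> 0" "?u \<noteq> 0"
      using i(1) \<open>i < n\<close> general_position_nonzero[OF less.prems(3), of "Suc i" i] by auto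
    have "1 = right_sum \<eta> n d ?x (\<lambda>k. of_bool (k \<in> S'))"
      using less.hyps[OF lt S' general_position_swap[OF less.prems(3) i(1) \<open>i < n\<close>]] by simp
    \<comment> \<open>The induction hypothesis for S' enters at both x and the exchanged point. The
      value at S is then determined because its coefficient ?u is nonzero.\<close>
    also have "\<dots> = (?u * right_sum \<eta> n d x (\<lambda>k. of_bool (k \<in> S)) + \<eta> * 1) / (?u + \<eta>)"
      using less.hyps[OF lt S' less.prems(3)]
      unfolding right_sum_exchange[OF refl i(1) \<open>i < n\<close> less.prems(3)]
      by (simp add: braid_op_def R_op_def perm_op_def ind comp_assoc)
    finally show ?thesis using ne by (simp add: divide_simps)
  next
    case False
    have down: "i \<in> S" if "k \<in> S" "1 \<le> i" "i \<le> k" for i k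
      using that(3,1,2)
    proof (induction i rule: inc_induct)
      case (step i)
      then show ?case using False by (meson le_SucI)
    qed
    have "S = {1..d}"
    proof (cases "S = {}")
      case True
      then show ?thesis using less.prems by simp
    next
      case ne: False
      have "S = {1..Max S}"
        using down[OF Max_in[OF fin ne]] less.prems(1) fin by auto
      then show ?thesis using less.prems(2) by (metis card_atLeastAtMost diff_Suc_1)
    qed
    then show ?thesis using right_sum_packed[OF dn less.prems(3)] by simp
  qed
qed

lemma right_sum_eq_elem_sym:
  assumes "general_position n \<eta> x"
  shows "right_sum \<eta> n d x = elem_sym d {1..n}"
proof (rule multilinear_form_eqI)
  show "multilinear_form {1..n} d (right_sum \<eta> n d x)"
    unfolding right_sum_def
  proof (rule multilinear_form_sum, rule multilinear_form_scale)
    fix I assume "I \<in> {I. I \<subseteq> {1..n} \<and> card I = d}"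
    then show "multilinear_form {1..n} d (right_prod \<eta> n x I 1)"
      using multilinear_form_right_prod[of 1 n I \<eta> x] by (simp add: Int_absorb2)
  qed
qed (use right_sum_indicator assms in auto)

subsection \<open>Reduction of the qKZ solution to covectors\<close>

text \<open>The function f stands for the covector with component f(g_{j_1}, ..., g_{j_n}) at J; the
  constant 1 gives the sum of all basis covectors.\<close>

definition pairing :: "nat \<Rightarrow> ('N \<Rightarrow> complex) \<Rightarrow> complex tensor \<Rightarrow> 'N tensor \<Rightarrow> complex" where
  "pairing n g f v = (\<Sum>J\<in>multi_indices n. f (g \<circ> J) * v J)"

lemma multi_indices_swap:
  assumes "i \<in> {1..n}" "k \<in> {1..n}" "J \<in> multi_indices n"
  shows "J \<circ> swap i k \<in> multi_indices n"
  using assms unfolding multi_indices_def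
  by (auto simp: PiE_def extensional_def Transposition.transpose_def)

lemma pairing_perm_op:
  assumes "i \<in> {1..n}" "k \<in> {1..n}"
  shows "pairing n g f (perm_op i k v) = pairing n g (perm_op i k f) v"
  unfolding pairing_def perm_op_def
  by (rule sum.reindex_bij_witness[of _ "\<lambda>J. J \<circ> swap i k" "\<lambda>J. J \<circ> swap i k"])
    (use multi_indices_swap[OF assms] in \<open>simp_all add: comp_assoc\<close>)

lemma pairing_R_op:
  assumes "i \<in> {1..n}" "k \<in> {1..n}"
  shows "pairing n g f (R_op \<eta> i k u v) = pairing n g (R_op \<eta> i k u f) v"
proof -
  have "pairing n g f (R_op \<eta> i k u v) = (u * pairing n g f v + \<eta> * pairing n g f (perm_op i k v)) / (u + \<eta>)"
    by (simp add: pairing_def R_op_def sum_distrib_left sum_divide_distrib add_divide_distrib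
        distrib_left sum.distrib mult_ac)
  also have "\<dots> = pairing n g (R_op \<eta> i k u f) v"
    unfolding pairing_perm_op[OF assms]
    by (simp add: pairing_def R_op_def sum_distrib_left sum_divide_distrib add_divide_distrib
        distrib_left sum.distrib mult_ac)
  finally show ?thesis .
qed

lemma pairing_site_op: "pairing n g f (site_op i (diag_mat g) v) = pairing n g (coord_mult i f) v"
proof -
  have "site_op i (diag_mat g) v J = g (J i) * v J" for J
  proof -
    have "site_op i (diag_mat g) v J = (\<Sum>b\<in>UNIV. if J i = b then g (J i) * v (J(i := b)) else 0)"
      unfolding site_op_def diag_mat_def by (intro sum.cong) auto
    then show ?thesis by (simp add: sum.delta)
  qed
  then show ?thesis by (simp add: pairing_def coord_mult_def mult_ac)
qed

text \<open>Each R-matrix is its own transpose, but transposition reverses the order of a product,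
  whence \<open>rev\<close>.\<close>

lemma pairing_op_prod:
  assumes "i \<in> {1..n}" "set ks \<subseteq> {1..n}"
  shows "pairing n g f (op_prod (map (\<lambda>k. R_op \<eta> i k (u k)) ks) v)
       = pairing n g (foldr (\<lambda>k. R_op \<eta> i k (u k)) (rev ks) f) v"
  using assms(2) by (induction ks arbitrary: f) (use assms(1) in \<open>auto simp: op_prod_def pairing_R_op\<close>)

text \<open>After transposition the factors to the left of g meet f first and fix it by its
  symmetry. Their arguments are differences at the shifted point, so general position there keeps
  their denominators nonzero.\<close>

lemma pairing_qKZ_op:
  assumes i: "i \<in> {1..n}" and gen: "general_position n \<eta> (x(i := x i + \<eta> * hbar))"
    and f: "\<And>k. k < i \<Longrightarrow> perm_op i k f = f"
  shows "pairing n g f (qKZ_op n \<eta> hbar (diag_mat g) i x v) = pairing n g (right_op \<eta> n x i f) v"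
proof -
  have "foldr (\<lambda>k. R_op \<eta> i k (x i - x k + \<eta> * hbar)) [1..<i] f = f"
  proof (rule foldr_invariant[where P = "\<lambda>h. h = f"])
    fix k h assume "k \<in> set [1..<i]" and h: "h = f"
    then have k: "k < i" "k \<in> {1..n}" using i by auto
    then have "x i - x k + \<eta> * hbar + \<eta> \<noteq> 0"
      using general_position_nonzero(2)[OF gen i k(2)] by (simp add: algebra_simps)
    then show "R_op \<eta> i k (x i - x k + \<eta> * hbar) h = f"
      using f[OF k(1)] h by (simp add: R_op_fixed)
  qed simp
  moreover have "set (rev [1..<i]) \<subseteq> {1..n}" "set (rev [i+1..<n+1]) \<subseteq> {1..n}" using i by auto
  ultimately show ?thesis
    unfolding qKZ_op_def right_op_def o_apply
    by (simp only: pairing_op_prod[OF i] pairing_site_op rev_rev_ident)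
qed

section \<open>Products of shifts applied to a solution\<close>

lemma op_prod_shift_op:
  assumes "distinct ks"
  shows "op_prod (map (shift_op h) ks) f x = f (\<lambda>k. if k \<in> set ks then x k + h else x k)"
  using assms
proof (induction ks arbitrary: x)
  case (Cons k ks)
  have "op_prod (map (shift_op h) (k # ks)) f x = op_prod (map (shift_op h) ks) f (x(k := x k + h))"
    by (simp add: op_prod_def shift_op_def)
  also have "\<dots> = f (\<lambda>j. if j \<in> set (k # ks) then x j + h else x j)"
    using Cons by (auto intro!: arg_cong[of _ _ f])
  finally show ?case .
qed (simp add: op_prod_def)

lemma pairing_shifted:
  fixes g :: "'N::finite \<Rightarrow> complex"
  assumes X: "\<And>x i. x \<in> X \<Longrightarrow> i \<in> {1..n} \<Longrightarrow> x(i := x i + \<eta> * hbar) \<in> X"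
    and gen: "\<And>x. x \<in> X \<Longrightarrow> general_position n \<eta> x"
    and qKZ: "\<And>x i. x \<in> X \<Longrightarrow> i \<in> {1..n} \<Longrightarrow>
           shift_op (\<eta> * hbar) i \<Phi> x = qKZ_op n \<eta> hbar (diag_mat g) i x (\<Phi> x)"
    and x: "x \<in> X" and I: "I \<subseteq> {1..n}"
  defines "y \<equiv> \<lambda>k. if k \<in> I then x k + \<eta> * hbar else x k"
  shows "y \<in> X" "pairing n g (\<lambda>z. 1) (\<Phi> y) = pairing n g (right_prod \<eta> n x I 1) (\<Phi> x)"
proof -
  \<comment> \<open>At \<open>w m\<close> only the indices of I below m are shifted. Lowering m from
    n + 1 to 1 removes the shifts one at a time, each by one qKZ equation.\<close>
  define w where "w m = (\<lambda>k. if k \<in> I \<and> k < m then x k + \<eta> * hbar else x k)" for m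
  have w1: "w 1 = x" using I by (fastforce simp: w_def fun_eq_iff)
  have w_end: "w (Suc n) = y" using I by (fastforce simp: w_def y_def fun_eq_iff)
  have w_step: "w (Suc m) = (if m \<in> I then (w m)(m := w m m + \<eta> * hbar) else w m)" for m
    by (auto simp: w_def fun_eq_iff less_Suc_eq)
  have wX: "w (Suc m) \<in> X" for m
  proof (induction m)
    case (Suc m)
    then show ?case using X[OF Suc] I w_step[of "Suc m"] by (auto split: if_splits)
  qed (use w1 x in simp)
  have step: "pairing n g (right_prod \<eta> n x I (Suc m)) (\<Phi> (w (Suc m)))
      = pairing n g (right_prod \<eta> n x I m) (\<Phi> (w m))" if m: "m \<in> {1..n}" for m
  proof (cases "m \<in> I")
    case True
    let ?f = "right_prod \<eta> n x I (Suc m)"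
    have wm: "w m \<in> X" using wX[of "m - 1"] m by simp
    have "\<Phi> (w (Suc m)) = qKZ_op n \<eta> hbar (diag_mat g) m (w m) (\<Phi> (w m))"
      using qKZ[OF wm m] True by (simp add: w_step shift_op_def)
    then have "pairing n g ?f (\<Phi> (w (Suc m))) = pairing n g (right_op \<eta> n (w m) m ?f) (\<Phi> (w m))"
      using pairing_qKZ_op[OF m gen[OF X[OF wm m]], of ?f g "\<Phi> (w m)"]
      by (simp add: perm_op_right_prod)
    \<comment> \<open>\<open>right_op\<close> at m depends only on coordinates from m on, and there
      \<open>w m\<close> agrees with x.\<close>
    also have "right_op \<eta> n (w m) m ?f = right_prod \<eta> n x I m"
      using m True right_op_cong[of m n "w m" x \<eta> ?f] by (simp add: right_prod_step w_def)
    finally show ?thesis .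
  qed (use m in \<open>simp add: w_step right_prod_step\<close>)
  have "pairing n g (right_prod \<eta> n x I (Suc m)) (\<Phi> (w (Suc m))) = pairing n g (right_prod \<eta> n x I 1) (\<Phi> x)"
    if "m \<le> n" for m
    using that by (induction m) (use w1 step in auto)
  from this[of n] show "pairing n g (\<lambda>z. 1) (\<Phi> y) = pairing n g (right_prod \<eta> n x I 1) (\<Phi> x)"
    by (simp add: w_end)
  show "y \<in> X" using wX[of n] w_end by simp
qed

section \<open>The eigenvalue\<close>

lemma elem_sym_bij_betw:
  assumes b: "bij_betw b A B" and z: "\<And>k. k \<in> A \<Longrightarrow> w (b k) = z k"
  shows "elem_sym d A z = elem_sym d B w"
proof -
  have inj: "inj_on b S" if "S \<subseteq> A" for S
    using b that by (meson bij_betw_def inj_on_subset)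
  have "bij_betw (image b) {S. S \<subseteq> A \<and> card S = d} {S. S \<subseteq> B \<and> card S = d}"
  proof -
    have "image b ` {S. S \<subseteq> A \<and> card S = d} = {S. S \<subseteq> B \<and> card S = d}"
    proof (intro equalityI subsetI)
      fix T assume "T \<in> image b ` {S. S \<subseteq> A \<and> card S = d}"
      then show "T \<in> {S. S \<subseteq> B \<and> card S = d}"
        using b by (auto simp: bij_betw_def card_image[OF inj])
    next
      fix T assume T: "T \<in> {S. S \<subseteq> B \<and> card S = d}"
      then obtain S where S: "S \<subseteq> A" "T = b ` S" using b by (auto simp: bij_betw_def subset_image_iff)
      then have "card S = d" using T by (simp add: card_image[OF inj])
      then show "T \<in> image b ` {S. S \<subseteq> A \<and> card S = d}" using S by blast
    qed
    then show ?thesis by (intro bij_betw_subset[OF bij_betw_Pow[OF b]]) auto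
  qed
  moreover have "(\<Prod>k\<in>b ` S. w k) = (\<Prod>k\<in>S. z k)" if "S \<subseteq> A" for S
    using that z by (subst prod.reindex[OF inj]) (auto intro!: prod.cong)
  ultimately show ?thesis
    unfolding elem_sym_def by (subst sum.reindex_bij_betw[symmetric]) (auto intro!: sum.cong)
qed

lemma elem_sym_weight_index:
  fixes J :: "nat \<Rightarrow> 'N::finite"
  assumes "J \<in> weight_indices n M"
  shows "elem_sym d {1..n} (g \<circ> J) = MR_eigenvalue d g M"
proof -
  have "\<exists>h. bij_betw h {i \<in> {1..n}. J i = a} {1..M a}" for a
    using assms by (intro finite_same_card_bij) (auto simp: weight_indices_def)
  \<comment> \<open>\<open>h a\<close> numbers the positions at which J takes the value a, so i
    corresponds to the pair of its value and its number.\<close>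
  then obtain h where h: "\<And>a. bij_betw (h a) {i \<in> {1..n}. J i = a} {1..M a}" by metis
  have "bij_betw (\<lambda>i. (J i, h (J i) i)) {1..n} (SIGMA a:UNIV. {1..M a})"
    unfolding bij_betw_def
  proof
    show "inj_on (\<lambda>i. (J i, h (J i) i)) {1..n}"
    proof (rule inj_onI)
      fix i k assume "i \<in> {1..n}" "k \<in> {1..n}" "(J i, h (J i) i) = (J k, h (J k) k)"
      then show "i = k" using bij_betw_imp_inj_on[OF h[of "J i"]] by (auto dest: inj_onD)
    qed
    show "(\<lambda>i. (J i, h (J i) i)) ` {1..n} = (SIGMA a:UNIV. {1..M a})"
    proof (intro equalityI subsetI)
      fix p assume "p \<in> (\<lambda>i. (J i, h (J i) i)) ` {1..n}"
      then obtain i where "i \<in> {1..n}" "p = (J i, h (J i) i)" by blast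
      then show "p \<in> (SIGMA a:UNIV. {1..M a})" using bij_betwE[OF h[of "J i"]] by simp
    next
      fix p assume "p \<in> (SIGMA a:UNIV. {1..M a})"
      then obtain a k where p: "p = (a, k)" "k \<in> {1..M a}" by auto
      then obtain i where "i \<in> {1..n}" "J i = a" "h a i = k"
        using bij_betw_imp_surj_on[OF h[of a]] by (metis (mono_tags, lifting) imageE mem_Collect_eq)
      then show "p \<in> (\<lambda>i. (J i, h (J i) i)) ` {1..n}" using p by force
    qed
  qed
  then show ?thesis unfolding MR_eigenvalue_def by (rule elem_sym_bij_betw) simp
qed

section \<open>Restriction to the weight subspace and conclusion\<close>

lemma weight_space_eq_0:
  assumes "v \<in> weight_space n M" "J \<notin> weight_indices n M"
  shows "v J = 0"
  using assms unfolding weight_space_def ket_def by (auto intro!: sum.neutral)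

lemma finite_multi_indices: "finite (multi_indices n :: (nat \<Rightarrow> 'N::finite) set)"
  unfolding multi_indices_def by (intro finite_PiE) auto

lemma sum_multi_indices:
  fixes v :: "'N::finite tensor"
  assumes "v \<in> weight_space n M"
  shows "(\<Sum>J\<in>multi_indices n. c J * v J) = (\<Sum>J\<in>weight_indices n M. c J * v J)"
  using weight_space_eq_0[OF assms] finite_multi_indices
  by (intro sum.mono_neutral_right) (auto simp: weight_indices_def)

theorem mainTheorem2:
  fixes n :: nat and \<eta> hbar :: complex
    and g :: "'N::finite \<Rightarrow> complex" and M :: "'N \<Rightarrow> nat"
    and X :: "(nat \<Rightarrow> complex) set"
    and \<Phi> :: "(nat \<Rightarrow> complex) \<Rightarrow> 'N tensor"
    and \<Psi> :: "(nat \<Rightarrow> complex) \<Rightarrow> complex"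
  assumes "n \<ge> 1"
    and "invertible (diag_mat g)"
    and "(\<Sum>a\<in>UNIV. M a) = n"
    and "X \<subseteq> {1..n} \<rightarrow>\<^sub>E UNIV"
    and "\<And>x i. x \<in> X \<Longrightarrow> i \<in> {1..n} \<Longrightarrow> x(i := x i + \<eta> * hbar) \<in> X"
    and "\<And>x. x \<in> X \<Longrightarrow> general_position n \<eta> x"
    and "\<And>x. x \<in> X \<Longrightarrow> \<Phi> x \<in> weight_space n M"
    and "\<And>x i. x \<in> X \<Longrightarrow> i \<in> {1..n} \<Longrightarrow>
           shift_op (\<eta> * hbar) i \<Phi> x = qKZ_op n \<eta> hbar (diag_mat g) i x (\<Phi> x)"
    and "\<And>x. x \<in> X \<Longrightarrow> \<Psi> x = (\<Sum>J\<in>weight_indices n M. \<Phi> x J)"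
  shows "\<forall>d\<in>{1..n}. \<forall>x\<in>X. MR_hamiltonian n \<eta> hbar d \<Psi> x = MR_eigenvalue d g M * \<Psi> x"
proof (intro ballI)
  fix d x assume x: "x \<in> X"
  let ?S = "{I. I \<subseteq> {1..n} \<and> card I = d}"
  have \<Psi>: "\<Psi> y = pairing n g (\<lambda>z. 1) (\<Phi> y)" if "y \<in> X" for y
    using assms(9)[OF that] sum_multi_indices[OF assms(7)[OF that], of "\<lambda>_. 1"] by (simp add: pairing_def)
  have shifted: "op_prod (map (shift_op (\<eta> * hbar)) (sorted_list_of_set I)) \<Psi> x
      = pairing n g (right_prod \<eta> n x I 1) (\<Phi> x)" if I: "I \<subseteq> {1..n}" for I
  proof -
    have "finite I" using I finite_subset by blast
    then show ?thesis
      using pairing_shifted[OF assms(5,6,8) x I] by (simp add: op_prod_shift_op \<Psi>)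
  qed
  have "MR_hamiltonian n \<eta> hbar d \<Psi> x
      = (\<Sum>I\<in>?S. weight \<eta> n x I * pairing n g (right_prod \<eta> n x I 1) (\<Phi> x))"
    unfolding MR_hamiltonian_def weight_def by (intro sum.cong) (simp_all add: shifted)
  \<comment> \<open>The sums over I and J are interchanged, which collects the covectors of all I
    into one.\<close>
  also have "\<dots> = pairing n g (right_sum \<eta> n d x) (\<Phi> x)"
    unfolding pairing_def right_sum_def sum_distrib_left sum_distrib_right
    by (subst sum.swap) (simp only: mult.assoc)
  \<comment> \<open>Only multi-indices of weight M contribute, and on them the elementary symmetric
    polynomial in g_{j_1}, ..., g_{j_n} is constant.\<close>
  also have "\<dots> = (\<Sum>J\<in>weight_indices n M. elem_sym d {1..n} (g \<circ> J) * \<Phi> x J)"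
    unfolding right_sum_eq_elem_sym[OF assms(6)[OF x]] pairing_def
    by (rule sum_multi_indices[OF assms(7)[OF x]])
  also have "\<dots> = MR_eigenvalue d g M * \<Psi> x"
    unfolding assms(9)[OF x] sum_distrib_left
    by (intro sum.cong refl) (simp only: elem_sym_weight_index)
  finally show "MR_hamiltonian n \<eta> hbar d \<Psi> x = MR_eigenvalue d g M * \<Psi> x" .
qed

end
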